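(* Let $A=(c_{ij}x^{\alpha_{ij}})$ be a multigraded squarefree $s\times l$ matrix over $R=\Bbbk[x_1,\ldots,x_n]$, let $T=(\gamma_1,\ldots,\gamma_l,\beta_1,\ldots,\beta_s)$ be a squarefree solution of the system $E_A$, let $\phi_T:F_1\to F_0$ be the associated map of free modules, and let $>$ be a term order on $F_0$ obtained from a monomial order on $R$ and a total ordering of the basis elements $v_1,\ldots,v_s$ of $F_0$ by the rule: $u v_i>u' v_j$ if $v_i>v_j$, or $i=j$ and $u>u'$ ($u,u'$ monomials of $R$). Then there exist squarefree monomial ideals $I_1,\ldots,I_s$ of $R$ such that $$\mathrm{in}(\mathrm{Im}\,\phi_T)=I_1v_1\oplus\cdots\oplus I_sv_s .$$
   Context: $\Bbbk$ is a field of characteristic $0$, $R=\Bbbk[x_1,\ldots,x_n]$, $[t]=\{1,\ldots,t\}$, and $x^\alpha=x_1^{a_1}\cdots x_n^{a_n}$ for $\alpha=(a_1,\dots,a_n)$. A vector is squarefree if it lies in $\{0,1\}^n$; a collection of vectors is squarefree if each of its vectors is. An $s\times l$ matrix $A=(c_{ij}x^{\alpha_{ij}})$ with $c_{ij}\in\Bbbk$, $\alpha_{ij}\in\mathbb N^n$ is multigraded if every minor of $A$ equals $c\,x^{\alpha}$ for some $c\in\Bbbk$ (possibly $0$) and some $\alpha\in\mathbb N^n$. The system $E_A$ consists of the equations $\gamma_j-\beta_i=\alpha_{ij}$, one for each $(i,j)$ with $c_{ij}\ne0$, in the unknown vectors $\gamma_1,\ldots,\gamma_l,\beta_1,\ldots,\beta_s$.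 A multigraded matrix $A$ is squarefree if $E_A$ has a squarefree solution $T=(\gamma_1,\ldots,\gamma_l,\beta_1,\ldots,\beta_s)$. For a solution $T$, $F_1$ and $F_0$ are the multigraded free $R$-modules with bases $\{w_j:j\in[l]\}$, $\deg w_j=\gamma_j$, and $\{v_i:i\in[s]\}$, $\deg v_i=\beta_i$, and $\phi_T:F_1\to F_0$ is the $R$-linear map $\phi_T(w_j)=\sum_i c_{ij}x^{\alpha_{ij}}v_i$. $\mathrm{in}(N)$ denotes the initial module of a submodule $N\subset F_0$ with respect to $>$, i.e. the submodule generated by the leading terms of the elements of $N$. *)

theory Defs
  imports
    "HOL-Library.Poly_Mapping"
    "HOL-Algebra.Ideal"
    "Jordan_Normal_Form.DL_Submatrix"
    "Jordan_Normal_Form.Determinant"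
    "Jordan_Normal_Form.VS_Connect"
begin

text \<open>
  The variables of \<open>R\<close> are indexed by a finite type \<open>'n\<close>; a monomial is identified with its exponent
  vector, and \<open>c x^a\<close> is \<open>Poly_Mapping.single a c\<close>.  Indices in \<open>[t]\<close> are shifted to \<open>{..<t}\<close>.
  The free modules \<open>F\<^sub>1\<close> and \<open>F\<^sub>0\<close> are \<open>carrier_vec l\<close> and \<open>carrier_vec s\<close>, their bases being the unit
  vectors.
\<close>

type_synonym 'n monom = "'n \<Rightarrow>\<^sub>0 nat"
type_synonym ('n, 'k) polyring = "'n monom \<Rightarrow>\<^sub>0 'k"

definition squarefree_vec :: "('n \<Rightarrow> 'a::zero_neq_one) \<Rightarrow> bool" where
  "squarefree_vec v \<longleftrightarrow> (\<forall>k. v k \<in> {0, 1})"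


subsection \<open>Multigraded and squarefree matrices\<close>

definition term_matrix ::
  "nat \<Rightarrow> nat \<Rightarrow> (nat \<Rightarrow> nat \<Rightarrow> 'k::field_char_0) \<Rightarrow> (nat \<Rightarrow> nat \<Rightarrow> 'n::finite monom)
    \<Rightarrow> ('n, 'k) polyring mat" where
  "term_matrix s l c \<alpha> = mat s l (\<lambda>(i, j). Poly_Mapping.single (\<alpha> i j) (c i j))"

(* The empty minor (I = J = {}) equals 1 and imposes no condition. *)
definition multigraded :: "('n::finite, 'k::field_char_0) polyring mat \<Rightarrow> bool" where
  "multigraded A \<longleftrightarrow>
    (\<forall>I J. I \<subseteq> {..<dim_row A} \<and> J \<subseteq> {..<dim_col A} \<and> card I = card J \<longrightarrow>
      (\<exists>a b. det (submatrix A I J) = Poly_Mapping.single a b))"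

(* The unknown vectors are taken in Z^n. *)
definition solves_E ::
  "nat \<Rightarrow> nat \<Rightarrow> (nat \<Rightarrow> nat \<Rightarrow> 'k::field_char_0) \<Rightarrow> (nat \<Rightarrow> nat \<Rightarrow> 'n::finite monom)
    \<Rightarrow> (nat \<Rightarrow> 'n \<Rightarrow> int) \<Rightarrow> (nat \<Rightarrow> 'n \<Rightarrow> int) \<Rightarrow> bool" where
  "solves_E s l c \<alpha> \<gamma> \<beta> \<longleftrightarrow>
    (\<forall>i<s. \<forall>j<l. c i j \<noteq> 0 \<longrightarrow> (\<forall>k. \<gamma> j k - \<beta> i k = int (Poly_Mapping.lookup (\<alpha> i j) k)))"

definition squarefree_solution ::
  "nat \<Rightarrow> nat \<Rightarrow> (nat \<Rightarrow> nat \<Rightarrow> 'k::field_char_0) \<Rightarrow> (nat \<Rightarrow> nat \<Rightarrow> 'n::finite monom)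
    \<Rightarrow> (nat \<Rightarrow> 'n \<Rightarrow> int) \<Rightarrow> (nat \<Rightarrow> 'n \<Rightarrow> int) \<Rightarrow> bool" where
  "squarefree_solution s l c \<alpha> \<gamma> \<beta> \<longleftrightarrow>
    solves_E s l c \<alpha> \<gamma> \<beta> \<and> (\<forall>j<l. squarefree_vec (\<gamma> j)) \<and> (\<forall>i<s. squarefree_vec (\<beta> i))"

definition squarefree_matrix ::
  "nat \<Rightarrow> nat \<Rightarrow> (nat \<Rightarrow> nat \<Rightarrow> 'k::field_char_0) \<Rightarrow> (nat \<Rightarrow> nat \<Rightarrow> 'n::finite monom) \<Rightarrow> bool" where
  "squarefree_matrix s l c \<alpha> \<longleftrightarrow>
    multigraded (term_matrix s l c \<alpha>) \<and> (\<exists>\<gamma> \<beta>. squarefree_solution s l c \<alpha> \<gamma> \<beta>)"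


subsection \<open>The map of free modules\<close>

(* A solution T of E_A only provides degrees for the basis elements (making the map homogeneous, see
   the lemma below); the underlying R-linear map does not depend on T. *)
definition phi ::
  "nat \<Rightarrow> nat \<Rightarrow> (nat \<Rightarrow> nat \<Rightarrow> 'k::field_char_0) \<Rightarrow> (nat \<Rightarrow> nat \<Rightarrow> 'n::finite monom)
    \<Rightarrow> ('n, 'k) polyring vec \<Rightarrow> ('n, 'k) polyring vec" where
  "phi s l c \<alpha> w = term_matrix s l c \<alpha> *\<^sub>v w"

lemma phi_basis:
  assumes "j < l"
  shows "phi s l c \<alpha> (unit_vec l j) = vec s (\<lambda>i. Poly_Mapping.single (\<alpha> i j) (c i j))"
  using assms by (intro eq_vecI) (auto simp: phi_def term_matrix_def)

lemma phi_homogeneous: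
  assumes "solves_E s l c \<alpha> \<gamma> \<beta>" and "j < l" and "i < s"
    and "u \<in> Poly_Mapping.keys (phi s l c \<alpha> (unit_vec l j) $ i)"
  shows "int (Poly_Mapping.lookup u k) + \<beta> i k = \<gamma> j k"
proof -
  have "c i j \<noteq> 0" "u = \<alpha> i j"
    using assms by (auto simp: phi_basis split: if_splits)
  then have "\<gamma> j k - \<beta> i k = int (Poly_Mapping.lookup u k)"
    using assms(1-3) unfolding solves_E_def by blast
  then show ?thesis by simp
qed


subsection \<open>Term orders and initial modules\<close>

(* mord a b means x^a < x^b. *)
definition monomial_order :: "('n::finite monom \<Rightarrow> 'n monom \<Rightarrow> bool) \<Rightarrow> bool" where
  "monomial_order mord \<longleftrightarrow>
    irreflp mord \<and> transp mord \<and> totalp mord \<and>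
    (\<forall>a b d. mord a b \<longrightarrow> mord (a + d) (b + d)) \<and>
    (\<forall>a. a \<noteq> 0 \<longrightarrow> mord 0 a)"

(* bord i j means v_i < v_j. *)
definition basis_order :: "nat \<Rightarrow> (nat \<Rightarrow> nat \<Rightarrow> bool) \<Rightarrow> bool" where
  "basis_order s bord \<longleftrightarrow>
    irreflp_on {..<s} bord \<and> transp_on {..<s} bord \<and> totalp_on {..<s} bord"

(* The pair (u, i) stands for the module monomial x^u v_i. *)
definition term_less ::
  "('n::finite monom \<Rightarrow> 'n monom \<Rightarrow> bool) \<Rightarrow> (nat \<Rightarrow> nat \<Rightarrow> bool)
    \<Rightarrow> 'n monom \<times> nat \<Rightarrow> 'n monom \<times> nat \<Rightarrow> bool" where
  "term_less mord bord = (\<lambda>(u', j) (u, i). bord j i \<or> (i = j \<and> mord u' u))"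

definition monomials_of :: "('n::finite, 'k::field_char_0) polyring vec \<Rightarrow> ('n monom \<times> nat) set" where
  "monomials_of f = {(u, i). i < dim_vec f \<and> u \<in> Poly_Mapping.keys (f $ i)}"

(* Meaningful for f \<noteq> 0 only. *)
definition leading_monomial ::
  "('n::finite monom \<times> nat \<Rightarrow> 'n monom \<times> nat \<Rightarrow> bool) \<Rightarrow> ('n, 'k::field_char_0) polyring vec
    \<Rightarrow> 'n monom \<times> nat" where
  "leading_monomial tless f =
    (THE p. p \<in> monomials_of f \<and> (\<forall>q \<in> monomials_of f. q \<noteq> p \<longrightarrow> tless q p))"

definition leading_term ::
  "('n::finite monom \<times> nat \<Rightarrow> 'n monom \<times> nat \<Rightarrow> bool) \<Rightarrow> ('n, 'k::field_char_0) polyring vec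
    \<Rightarrow> ('n, 'k) polyring vec" where
  "leading_term tless f =
    (let (u, i) = leading_monomial tless f
     in Poly_Mapping.single u (Poly_Mapping.lookup (f $ i) u) \<cdot>\<^sub>v unit_vec (dim_vec f) i)"

definition initial_module ::
  "nat \<Rightarrow> ('n::finite monom \<times> nat \<Rightarrow> 'n monom \<times> nat \<Rightarrow> bool) \<Rightarrow> ('n, 'k::field_char_0) polyring vec set
    \<Rightarrow> ('n, 'k) polyring vec set" where
  "initial_module s tless N =
    LinearCombinations.module.span class_ring (module_vec TYPE(('n, 'k) polyring) s)
      (leading_term tless ` (N - {0\<^sub>v s}))"


subsection \<open>Squarefree monomial ideals and direct sums\<close>

definition squarefree_monomial_ideal :: "('n::finite, 'k::field_char_0) polyring set \<Rightarrow> bool" where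
  "squarefree_monomial_ideal I \<longleftrightarrow>
    (\<exists>S. (\<forall>a \<in> S. squarefree_vec (Poly_Mapping.lookup a)) \<and>
      I = Idl\<^bsub>class_ring\<^esub> ((\<lambda>a. Poly_Mapping.single a 1) ` S))"

(* I_1 v_1 + ... + I_s v_s inside F_0; the sum is direct because the v_i form a basis. *)
definition ideal_direct_sum ::
  "nat \<Rightarrow> (nat \<Rightarrow> ('n::finite, 'k::field_char_0) polyring set) \<Rightarrow> ('n, 'k) polyring vec set" where
  "ideal_direct_sum s I = {f \<in> carrier_vec s. \<forall>i<s. f $ i \<in> I i}"

end

theory Submission
  imports Defs
begin

text \<open>
  A squarefree solution grades the image \<open>N\<close> of \<open>phi\<close> by exponent vectors, with generators in squarefree
  degrees.  The leading term of \<open>f \<in> N\<close> is also the leading term of a homogeneous component of \<open>f\<close>, of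
  degree \<open>d\<close> say.  A generator divides degree \<open>d\<close> iff it divides the squarefree degree \<open>d' = min d 1\<close>, so
  the component of degree \<open>d\<close> is \<open>x\<^bsup>d-d'\<^esup>\<close> times an element of \<open>N\<close> of degree \<open>d'\<close>, whose leading monomial
  is squarefree.
\<close>

section \<open>Leading monomials\<close>

text \<open>The property that \<open>leading_monomial\<close> selects with \<open>THE\<close>, kept
  as a predicate so that a leading monomial can be exhibited and compared directly. No monomial
  satisfies it for a zero vector.\<close>

definition is_leading ::
  "('n::finite monom \<times> nat \<Rightarrow> 'n monom \<times> nat \<Rightarrow> bool) \<Rightarrow> ('n, 'k::field_char_0) polyring vec
    \<Rightarrow> 'n monom \<times> nat \<Rightarrow> bool" where
  "is_leading tless f p \<longleftrightarrow>
    p \<in> monomials_of f \<and> (\<forall>q \<in> monomials_of f. q \<noteq> p \<longrightarrow> tless q p)"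

lemma finite_monomials_of: "finite (monomials_of f)"
proof -
  have "monomials_of f \<subseteq> (\<Union>i<dim_vec f. Poly_Mapping.keys (f $ i) \<times> {i})"
    by (auto simp: monomials_of_def)
  then show ?thesis by (rule finite_subset) auto
qed

lemma monomials_of_nonempty:
  assumes "f \<in> carrier_vec s" and "f \<noteq> 0\<^sub>v s"
  shows "monomials_of f \<noteq> {}"
proof -
  from assms obtain i where "i < s" "f $ i \<noteq> 0"
    by (metis carrier_vecD eq_vecI index_zero_vec)
  moreover from this obtain u where "u \<in> Poly_Mapping.keys (f $ i)"
    by (metis keys_eq_empty ex_in_conv)
  ultimately show ?thesis using assms(1) by (auto simp: monomials_of_def)
qed

lemma finite_has_greatest:
  assumes "finite M" and "M \<noteq> {}" and "transp_on M r" and "totalp_on M r"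
  shows "\<exists>p \<in> M. \<forall>q \<in> M. q \<noteq> p \<longrightarrow> r q p"
  using assms
proof (induction M rule: finite_ne_induct)
  case (insert x F)
  then obtain p where p: "p \<in> F" "\<forall>q \<in> F. q \<noteq> p \<longrightarrow> r q p"
    by (meson totalp_on_subset transp_on_subset subset_insertI)
  have "x \<noteq> p" using p insert.hyps by auto
  with insert.prems p have "r x p \<or> r p x"
    by (metis insertCI totalp_onD)
  then show ?case
  proof
    assume "r x p"
    with p show ?thesis by auto
  next
    assume px: "r p x"
    have "r q x" if "q \<in> F" for q
      using px p that insert.prems(1) by (metis insertCI transp_onD)
    then show ?thesis by auto
  qed
qed auto

text \<open>\<open>basis_order\<close> constrains \<open>bord\<close> only on indices below
  \<open>s\<close>, hence the restriction to \<open>UNIV \<times> {..<s}\<close>, which contains the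
  monomials of every vector of length \<open>s\<close>.\<close>

lemma
  assumes "monomial_order mord" and "basis_order s bord"
  shows transp_on_term_less: "transp_on (UNIV \<times> {..<s}) (term_less mord bord)"
    and totalp_on_term_less: "totalp_on (UNIV \<times> {..<s}) (term_less mord bord)"
    and irreflp_on_term_less: "irreflp_on (UNIV \<times> {..<s}) (term_less mord bord)"
proof -
  have m: "transp mord" "totalp mord" "irreflp mord"
    using assms by (auto simp: monomial_order_def)
  have b: "transp_on {..<s} bord" "totalp_on {..<s} bord" "irreflp_on {..<s} bord"
    using assms by (auto simp: basis_order_def)
  show "transp_on (UNIV \<times> {..<s}) (term_less mord bord)"
  proof (rule transp_onI, clarify)
    fix u i v j w k
    assume "i < s" "j < s" "k < s"
      and "term_less mord bord (u, i) (v, j)" "term_less mord bord (v, j) (w, k)"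
    then show "term_less mord bord (u, i) (w, k)"
      using transpD[OF m(1), of u v w] transp_onD[OF b(1), of i j k]
      by (auto simp: term_less_def)
  qed
  show "totalp_on (UNIV \<times> {..<s}) (term_less mord bord)"
  proof -
    have "term_less mord bord (u, i) (v, j) \<or> term_less mord bord (v, j) (u, i)"
      if "i < s" "j < s" "(u, i) \<noteq> (v, j)" for u i v j
      using that totalpD[OF m(2), of u v] totalp_onD[OF b(2), of i j]
      by (auto simp: term_less_def)
    then show ?thesis by (auto simp: totalp_on_def)
  qed
  show "irreflp_on (UNIV \<times> {..<s}) (term_less mord bord)"
    using m(3) b(3) by (auto simp: irreflp_on_def term_less_def)
qed

lemma monomials_of_subset: "f \<in> carrier_vec s \<Longrightarrow> monomials_of f \<subseteq> UNIV \<times> {..<s}"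
  by (auto simp: monomials_of_def)

lemma ex_is_leading:
  assumes "monomial_order mord" and "basis_order s bord" and "f \<in> carrier_vec s" and "f \<noteq> 0\<^sub>v s"
  shows "\<exists>p. is_leading (term_less mord bord) f p"
proof -
  have "transp_on (monomials_of f) (term_less mord bord)"
    using transp_on_term_less[OF assms(1,2)] monomials_of_subset[OF assms(3)]
    by (rule transp_on_subset)
  moreover have "totalp_on (monomials_of f) (term_less mord bord)"
    using totalp_on_term_less[OF assms(1,2)] monomials_of_subset[OF assms(3)]
    by (rule totalp_on_subset)
  ultimately show ?thesis
    using finite_has_greatest[OF finite_monomials_of monomials_of_nonempty[OF assms(3,4)]]
    unfolding is_leading_def by blast
qed

text \<open>Two distinct greatest monomials would each lie below the other, against transitivity and
  irreflexivity; so the description in \<open>leading_monomial\<close> is unique.\<close>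

lemma leading_monomial_eq:
  assumes "monomial_order mord" and "basis_order s bord" and "f \<in> carrier_vec s"
    and "is_leading (term_less mord bord) f p"
  shows "leading_monomial (term_less mord bord) f = p"
  unfolding leading_monomial_def
proof (rule the_equality)
  fix p'
  assume p': "p' \<in> monomials_of f \<and> (\<forall>q\<in>monomials_of f. q \<noteq> p' \<longrightarrow> term_less mord bord q p')"
  show "p' = p"
  proof (rule ccontr)
    assume "p' \<noteq> p"
    with p' assms(4) have "term_less mord bord p' p" "term_less mord bord p p'"
      and in_s: "p \<in> UNIV \<times> {..<s}" "p' \<in> UNIV \<times> {..<s}"
      using monomials_of_subset[OF assms(3)] by (auto simp: is_leading_def)
    then have "term_less mord bord p p"
      using transp_onD[OF transp_on_term_less[OF assms(1,2)]] by blast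
    with in_s show False
      using irreflp_onD[OF irreflp_on_term_less[OF assms(1,2)]] by blast
  qed
qed (use assms(4) in \<open>auto simp: is_leading_def\<close>)

lemma leading_term_eq:
  assumes "monomial_order mord" and "basis_order s bord" and "f \<in> carrier_vec s"
    and "is_leading (term_less mord bord) f (u, i)"
  shows "leading_term (term_less mord bord) f
    = Poly_Mapping.single u (Poly_Mapping.lookup (f $ i) u) \<cdot>\<^sub>v unit_vec s i"
  using leading_monomial_eq[OF assms] assms(3) by (simp add: leading_term_def)

lemma leading_term_carrier: "f \<in> carrier_vec s \<Longrightarrow> leading_term tless f \<in> carrier_vec s"
  by (cases "leading_monomial tless f") (simp add: leading_term_def)

text \<open>By totality the alternatives are \<open>a = b\<close> and \<open>mord b a\<close>;
  adding \<open>e\<close> to either contradicts the assumption. This permits division by a common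
  monomial when leading terms are compared.\<close>

lemma monomial_order_add_cancel:
  assumes "monomial_order mord" and "mord (a + e) (b + e)"
  shows "mord a b"
proof -
  have "irreflp mord" "transp mord" "totalp mord" "\<And>a b d. mord a b \<Longrightarrow> mord (a + d) (b + d)"
    using assms(1) by (auto simp: monomial_order_def)
  then show ?thesis
    using assms(2) by (metis UNIV_I irreflpD totalp_onD transpD)
qed


section \<open>Homogeneous components of the image\<close>

text \<open>Cancellation leaves \<open>m\<close> as the only exponent that \<open>a\<close>
  completes to \<open>a + m\<close>, so the convolution collapses to one summand.\<close>

lemma lookup_single_mult_add:
  fixes q :: "('a::cancel_comm_monoid_add) \<Rightarrow>\<^sub>0 ('b::semiring_0)"
  shows "Poly_Mapping.lookup (Poly_Mapping.single a c * q) (a + m) = c * Poly_Mapping.lookup q m"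
  by (simp only: lookup_mult lookup_single when_mult Sum_any_when_equal' add_left_cancel)

lemma lookup_single_mult_eq_0:
  fixes q :: "('a::cancel_comm_monoid_add) \<Rightarrow>\<^sub>0 ('b::semiring_0)"
  assumes "\<And>m. p \<noteq> a + m"
  shows "Poly_Mapping.lookup (Poly_Mapping.single a c * q) p = 0"
  by (simp only: lookup_mult lookup_single when_mult Sum_any_when_equal' assms when_simps
      Sum_any.neutral mult_zero_right)

text \<open>Degrees are integer vectors but exponents are natural, so differences of degrees pass
  through \<open>nat\<close>; negative entries become 0.\<close>

definition monom_of :: "('n::finite \<Rightarrow> int) \<Rightarrow> 'n monom" where
  "monom_of v = Abs_poly_mapping (\<lambda>k. nat (v k))"

lemma lookup_monom_of: "Poly_Mapping.lookup (monom_of v) k = nat (v k)"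
  by (simp add: monom_of_def)

lemma phi_index:
  assumes "w \<in> carrier_vec l" and "i < s"
  shows "phi s l c \<alpha> w $ i = (\<Sum>j<l. Poly_Mapping.single (\<alpha> i j) (c i j) * w $ j)"
proof -
  have "phi s l c \<alpha> w $ i = row (term_matrix s l c \<alpha>) i \<bullet> w"
    unfolding phi_def by (rule index_mult_mat_vec) (simp add: term_matrix_def assms(2))
  also have "\<dots> = (\<Sum>j<l. row (term_matrix s l c \<alpha>) i $ j * w $ j)"
    using assms(1) by (simp only: scalar_prod_def lessThan_atLeast0 carrier_vecD)
  finally show ?thesis
    using assms(2) by (simp add: term_matrix_def)
qed

lemma phi_carrier: "phi s l c \<alpha> w \<in> carrier_vec s"
  unfolding phi_def term_matrix_def by (rule carrier_vecI) (simp only: dim_mult_mat_vec dim_row_mat)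

text \<open>
  \<open>phi w'\<close> below is the homogeneous component of \<open>phi w\<close> of degree \<open>d + e\<close>, divided by \<open>x\<^bsup>e\<^esup>\<close>.
\<close>

lemma phi_component:
  fixes c :: "nat \<Rightarrow> nat \<Rightarrow> 'b::field_char_0"
  assumes "solves_E s l c \<alpha> \<gamma> \<beta>"
    and gen: "\<And>j. j < l \<Longrightarrow> \<forall>k. \<gamma> j k \<le> d k + int (Poly_Mapping.lookup e k) \<Longrightarrow> \<forall>k. \<gamma> j k \<le> d k"
    and w: "w \<in> carrier_vec l"
  obtains w' where "w' \<in> carrier_vec l"
    "\<And>i a. i < s \<Longrightarrow> Poly_Mapping.lookup (phi s l c \<alpha> w' $ i) a =
      (if \<forall>k. int (Poly_Mapping.lookup a k) + \<beta> i k = d k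
       then Poly_Mapping.lookup (phi s l c \<alpha> w $ i) (a + e) else 0)"
proof
  let ?m = "\<lambda>j. monom_of (\<lambda>k. d k - \<gamma> j k)"
  \<comment> \<open>In column \<open>j\<close>, \<open>phi\<close> raises degrees by
    \<open>\<gamma> j\<close>, so degree \<open>d + e\<close> of the image sees only the coefficient
    of \<open>w $ j\<close> at the exponent \<open>d + e - \<gamma> j\<close>. That one term is
    kept, divided by \<open>x^e\<close>; a column whose degree does not divide \<open>d\<close> gets
    0.\<close>
  define w' where "w' = vec l (\<lambda>j. if \<forall>k. \<gamma> j k \<le> d k
    then Poly_Mapping.single (?m j) (Poly_Mapping.lookup (w $ j) (?m j + e)) else 0)"
  show w': "w' \<in> carrier_vec l" by (simp add: w'_def)
  fix i a
  assume i: "i < s"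
  let ?hom = "\<forall>k. int (Poly_Mapping.lookup a k) + \<beta> i k = d k"
  have "Poly_Mapping.lookup (Poly_Mapping.single (\<alpha> i j) (c i j) * w' $ j) a =
      (if ?hom then Poly_Mapping.lookup (Poly_Mapping.single (\<alpha> i j) (c i j) * w $ j) (a + e) else 0)"
    if j: "j < l" for j
  proof (cases "c i j = 0")
    case False
    with assms(1) i j have deg: "\<gamma> j k = \<beta> i k + int (Poly_Mapping.lookup (\<alpha> i j) k)" for k
      unfolding solves_E_def by (metis add.commute diff_add_cancel)
    show ?thesis
    proof (cases "\<forall>k. \<gamma> j k \<le> d k")
      case True
      have hom: "?hom \<longleftrightarrow> a = \<alpha> i j + ?m j"
      proof -
        have "int (Poly_Mapping.lookup a k) + \<beta> i k = d k
            \<longleftrightarrow> Poly_Mapping.lookup a k = Poly_Mapping.lookup (\<alpha> i j + ?m j) k" for k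
          using True[rule_format, of k] deg[of k] by (auto simp: lookup_add lookup_monom_of)
        then show ?thesis by (simp add: poly_mapping_eq_iff fun_eq_iff)
      qed
      show ?thesis
      proof (cases ?hom)
        case True
        with hom have a: "a = \<alpha> i j + ?m j" by blast
        have "w' $ j = Poly_Mapping.single (?m j) (Poly_Mapping.lookup (w $ j) (?m j + e))"
          using \<open>\<forall>k. \<gamma> j k \<le> d k\<close> j by (simp add: w'_def)
        then have "Poly_Mapping.lookup (Poly_Mapping.single (\<alpha> i j) (c i j) * w' $ j) a
            = c i j * Poly_Mapping.lookup (w $ j) (?m j + e)"
          by (simp add: mult_single a)
        moreover have "a + e = \<alpha> i j + (?m j + e)" by (simp add: a add.assoc)
        ultimately show ?thesis
          unfolding if_P[OF True] by (simp only: lookup_single_mult_add)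
      next
        case False
        with hom show ?thesis
          using \<open>\<forall>k. \<gamma> j k \<le> d k\<close> j by (auto simp: w'_def mult_single lookup_single when_def)
      qed
    next
      case False
      \<comment> \<open>The discarded columns must not contribute to degree \<open>d + e\<close>
        either: a contribution would force \<open>\<gamma> j\<close> below \<open>d + e\<close>,
        hence below \<open>d\<close> by \<open>gen\<close>.\<close>
      have "a + e \<noteq> \<alpha> i j + m" if ?hom for m
      proof
        assume "a + e = \<alpha> i j + m"
        then have "Poly_Mapping.lookup (\<alpha> i j) k
            \<le> Poly_Mapping.lookup a k + Poly_Mapping.lookup e k" for k
          by (metis le_add1 lookup_add)
        then have "\<gamma> j k \<le> d k + int (Poly_Mapping.lookup e k)" for k
          using that[rule_format, of k] deg[of k] by (smt (verit) of_nat_add of_nat_mono)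
        with gen[OF j] False show False by blast
      qed
      then have "?hom \<Longrightarrow> Poly_Mapping.lookup (Poly_Mapping.single (\<alpha> i j) (c i j) * w $ j) (a + e) = 0"
        by (rule lookup_single_mult_eq_0)
      moreover have "w' $ j = 0"
        unfolding w'_def index_vec[OF j] using False by (rule if_not_P)
      ultimately show ?thesis by simp
    qed
  qed simp
  note term_component = this
  have sum_if: "(if P then sum h {..<l} else 0) = (\<Sum>j<l. if P then h j else 0)"
    for P and h :: "nat \<Rightarrow> 'b"
    by simp
  show "Poly_Mapping.lookup (phi s l c \<alpha> w' $ i) a =
      (if ?hom then Poly_Mapping.lookup (phi s l c \<alpha> w $ i) (a + e) else 0)"
    unfolding phi_index[OF w' i] phi_index[OF w i] lookup_sum sum_if
    by (rule sum.cong[OF refl], rule term_component) (rule lessThan_iff[THEN iffD1])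
qed

text \<open>Passing to one homogeneous component keeps the leading monomial, and dividing that
  component by \<open>x^e\<close> keeps the order of its monomials. The quotient stays in the image
  because squarefree column degrees cannot tell \<open>d + e\<close> from \<open>d\<close>.\<close>

lemma squarefree_leading_divisor:
  assumes "squarefree_solution s l c \<alpha> \<gamma> \<beta>" and "monomial_order mord"
    and "w \<in> carrier_vec l" and lead: "is_leading (term_less mord bord) (phi s l c \<alpha> w) (u, i)"
  obtains a e w' where "u = e + a" "squarefree_vec (Poly_Mapping.lookup a)" "w' \<in> carrier_vec l"
    "is_leading (term_less mord bord) (phi s l c \<alpha> w') (a, i)"
proof -
  let ?f = "phi s l c \<alpha> w"
  have sol: "solves_E s l c \<alpha> \<gamma> \<beta>"
    and \<gamma>: "\<And>j k. j < l \<Longrightarrow> \<gamma> j k \<in> {0, 1}" and \<beta>: "\<And>i k. i < s \<Longrightarrow> \<beta> i k \<in> {0, 1}"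
    using assms(1) by (auto simp: squarefree_solution_def squarefree_vec_def)
  have dim: "dim_vec (phi s l c \<alpha> v) = s" for v
    using phi_carrier by (rule carrier_vecD)
  have i: "i < s" and u: "u \<in> Poly_Mapping.keys (?f $ i)"
    using lead by (auto simp: is_leading_def monomials_of_def dim)
  \<comment> \<open>The monomial \<open>x^u v_i\<close> has degree \<open>u + \<beta> i\<close>.
    Here \<open>d\<close> is this degree cut off at 1, \<open>e\<close> is the excess over 1, and
    \<open>a\<close> is the exponent that places \<open>x^a v_i\<close> in degree \<open>d\<close>.
    Where the degree is 0 the excess would be -1, which \<open>monom_of\<close> turns into
    0.\<close>
  define d where "d = (\<lambda>k. min (int (Poly_Mapping.lookup u k) + \<beta> i k) 1)"
  define e where "e = monom_of (\<lambda>k. int (Poly_Mapping.lookup u k) + \<beta> i k - 1)"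
  define a where "a = monom_of (\<lambda>k. d k - \<beta> i k)"
  have de: "d k + int (Poly_Mapping.lookup e k) = int (Poly_Mapping.lookup u k) + \<beta> i k" for k
    using \<beta>[OF i, of k] by (auto simp: d_def e_def lookup_monom_of)
  have ad: "int (Poly_Mapping.lookup a k) + \<beta> i k = d k" for k
    using \<beta>[OF i, of k] by (auto simp: a_def d_def lookup_monom_of)
  have ua: "u = a + e"
  proof (rule poly_mapping_eqI)
    fix k
    show "Poly_Mapping.lookup u k = Poly_Mapping.lookup (a + e) k"
      using de[of k] ad[of k] by (simp add: lookup_add)
  qed
  have "Poly_Mapping.lookup a k \<in> {0, 1}" for k
    using ad[of k] \<beta>[OF i, of k] by (auto simp: d_def)
  then have sqf: "squarefree_vec (Poly_Mapping.lookup a)"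
    by (simp add: squarefree_vec_def)
  \<comment> \<open>Since \<open>\<gamma> j k\<close> is at most 1, it is bounded by a number as
    soon as it is bounded by it before the cut at 1.\<close>
  have gen: "\<forall>k. \<gamma> j k \<le> d k"
    if "j < l" "\<forall>k. \<gamma> j k \<le> d k + int (Poly_Mapping.lookup e k)" for j
  proof
    fix k
    show "\<gamma> j k \<le> d k"
      using that(2)[rule_format, of k] \<gamma>[OF that(1), of k] by (auto simp: de) (auto simp: d_def)
  qed
  obtain w' where w': "w' \<in> carrier_vec l"
    and lookup: "\<And>i a. i < s \<Longrightarrow> Poly_Mapping.lookup (phi s l c \<alpha> w' $ i) a =
      (if \<forall>k. int (Poly_Mapping.lookup a k) + \<beta> i k = d k
       then Poly_Mapping.lookup (?f $ i) (a + e) else 0)"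
    using phi_component[OF sol gen assms(3)] by blast
  let ?g = "phi s l c \<alpha> w'"
  have "(a, i) \<in> monomials_of ?g"
    using i u ad by (simp add: monomials_of_def dim in_keys_iff lookup ua)
  moreover have "term_less mord bord (a', i') (a, i)"
    if q: "(a', i') \<in> monomials_of ?g" "(a', i') \<noteq> (a, i)" for a' i'
  proof -
    \<comment> \<open>Multiplication by \<open>x^e\<close> sends monomials of \<open>?g\<close> to
      monomials of \<open>?f\<close>, where \<open>(u, i)\<close> is greatest; the factor is then
      cancelled again.\<close>
    from q(1) have "(a' + e, i') \<in> monomials_of ?f"
      by (auto simp: monomials_of_def dim in_keys_iff lookup split: if_splits)
    moreover have "(a' + e, i') \<noteq> (u, i)" using q(2) ua by auto
    ultimately have "term_less mord bord (a' + e, i') (a + e, i)"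
      using lead ua by (auto simp: is_leading_def)
    then show ?thesis
      using monomial_order_add_cancel[OF assms(2)] by (auto simp: term_less_def)
  qed
  ultimately have "is_leading (term_less mord bord) ?g (a, i)"
    by (auto simp: is_leading_def)
  moreover have "u = e + a" unfolding ua by (rule add.commute)
  ultimately show ?thesis using that sqf w' by blast
qed


section \<open>Monomial ideals and the initial module\<close>

lemma ideal_class_ringI:
  fixes I :: "'a::comm_ring_1 set"
  assumes "0 \<in> I" and "\<And>p q. p \<in> I \<Longrightarrow> q \<in> I \<Longrightarrow> p + q \<in> I" and "\<And>r p. p \<in> I \<Longrightarrow> r * p \<in> I"
  shows "ideal I class_ring"
proof (rule idealI)
  show "ring (class_ring :: 'a ring)" by (rule class_ring.ring_axioms)
  \<comment> \<open>The subgroup condition unfolds to inverses in the additive monoid record; they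
    are identified with \<open>uminus\<close>, so closure under negation follows from multiplication
    by -1.\<close>
  have inv_eq: "inv\<^bsub>\<lparr>carrier = UNIV, monoid.mult = (+), one = 0\<rparr>\<^esub> p = - p" for p :: 'a
  proof -
    have "a_inv class_ring = (uminus :: 'a \<Rightarrow> 'a)" by (simp add: class_ring_simps)
    from fun_cong[OF this, of p] show ?thesis by (simp add: a_inv_def)
  qed
  have "- p \<in> I" if "p \<in> I" for p
    using assms(3)[OF that, of "-1"] by simp
  then show "subgroup I (add_monoid class_ring)"
    using assms by unfold_locales (auto simp: inv_eq)
qed (use assms in \<open>auto simp: mult.commute\<close>)

lemma idealD_class_ring:
  fixes I :: "'a::comm_ring_1 set"
  assumes "ideal I class_ring"
  shows "0 \<in> I" and "p \<in> I \<Longrightarrow> q \<in> I \<Longrightarrow> p + q \<in> I" and "p \<in> I \<Longrightarrow> r * p \<in> I"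
proof -
  interpret ideal I class_ring by fact
  show "0 \<in> I" using zero_closed by simp
  show "p \<in> I \<Longrightarrow> q \<in> I \<Longrightarrow> p + q \<in> I" using a_closed by simp
  show "p \<in> I \<Longrightarrow> r * p \<in> I" using I_l_closed[of p r] by simp
qed

section \<open>Submodules and spans in free modules\<close>

lemma submodule_module_vecI:
  fixes N :: "'a::comm_ring_1 vec set"
  assumes "N \<subseteq> carrier_vec s" and "0\<^sub>v s \<in> N" and "\<And>x y. x \<in> N \<Longrightarrow> y \<in> N \<Longrightarrow> x + y \<in> N"
    and "\<And>r x. x \<in> N \<Longrightarrow> r \<cdot>\<^sub>v x \<in> N"
  shows "submodule class_ring N (module_vec TYPE('a) s)"
proof -
  interpret vec_module "TYPE('a)" s .
  show ?thesis
    using assms module_axioms by (simp add: submodule_def module_vec_simps)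
qed

lemma submodule_module_vecD:
  fixes N :: "'a::comm_ring_1 vec set"
  assumes "submodule class_ring N (module_vec TYPE('a) s)"
  shows "N \<subseteq> carrier_vec s" and "0\<^sub>v s \<in> N" and "x \<in> N \<Longrightarrow> y \<in> N \<Longrightarrow> x + y \<in> N"
    and "x \<in> N \<Longrightarrow> r \<cdot>\<^sub>v x \<in> N"
  using assms by (auto simp: submodule_def module_vec_simps)

text \<open>Restates the span facts of the locale \<open>vec_module\<close> for the explicit term
  that occurs in \<open>initial_module\<close>.\<close>

lemma
  fixes X :: "'a::comm_ring_1 vec set" and s :: nat
  defines "spn \<equiv> LinearCombinations.module.span class_ring (module_vec TYPE('a) s)"
  shows submodule_span_vec:
      "X \<subseteq> carrier_vec s \<Longrightarrow> submodule class_ring (spn X) (module_vec TYPE('a) s)"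
    and span_vec_superset: "X \<subseteq> carrier_vec s \<Longrightarrow> X \<subseteq> spn X"
    and span_vec_least:
      "X \<subseteq> N \<Longrightarrow> submodule class_ring N (module_vec TYPE('a) s) \<Longrightarrow> spn X \<subseteq> N"
proof -
  interpret vec_module "TYPE('a)" s .
  show "X \<subseteq> carrier_vec s \<Longrightarrow> submodule class_ring (spn X) (module_vec TYPE('a) s)"
    unfolding spn_def by (rule span_is_submodule)
  show "X \<subseteq> carrier_vec s \<Longrightarrow> X \<subseteq> spn X"
    unfolding spn_def by (rule in_own_span)
  show "X \<subseteq> N \<Longrightarrow> submodule class_ring N (module_vec TYPE('a) s) \<Longrightarrow> spn X \<subseteq> N"
    unfolding spn_def by (rule span_is_subset)
qed

lemma submodule_ideal_direct_sum:
  fixes I :: "nat \<Rightarrow> ('n::finite, 'k::field_char_0) polyring set"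
  assumes "\<And>i. i < s \<Longrightarrow> ideal (I i) class_ring"
  shows "submodule class_ring (ideal_direct_sum s I) (module_vec TYPE(('n, 'k) polyring) s)"
  using idealD_class_ring[OF assms]
  by (intro submodule_module_vecI) (auto simp: ideal_direct_sum_def)

lemma vec_in_submodule:
  fixes N :: "'a::comm_ring_1 vec set"
  assumes N: "submodule class_ring N (module_vec TYPE('a) s)" and f: "f \<in> carrier_vec s"
    and comp: "\<And>i. i < s \<Longrightarrow> f $ i \<cdot>\<^sub>v unit_vec s i \<in> N"
  shows "f \<in> N"
proof -
  \<comment> \<open>Induction on the number \<open>m\<close> of leading coordinates of
    \<open>f\<close> that are retained; each step adds one multiple of a unit vector.\<close>
  have "vec s (\<lambda>i. if i < m then f $ i else 0) \<in> N" if "m \<le> s" for m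
    using that
  proof (induction m)
    case 0
    have "vec s (\<lambda>i. if i < 0 then f $ i else 0) = 0\<^sub>v s" by auto
    then show ?case using submodule_module_vecD(2)[OF N] by simp
  next
    case (Suc m)
    have "vec s (\<lambda>i. if i < Suc m then f $ i else 0)
        = vec s (\<lambda>i. if i < m then f $ i else 0) + f $ m \<cdot>\<^sub>v unit_vec s m"
      using Suc.prems by (intro eq_vecI) (auto simp: less_Suc_eq)
    then show ?case
      using Suc submodule_module_vecD(3)[OF N] comp[of m] by simp
  qed
  from this[of s] have "vec s (\<lambda>i. if i < s then f $ i else 0) \<in> N" by simp
  moreover have "vec s (\<lambda>i. if i < s then f $ i else 0) = f" using f by (intro eq_vecI) auto
  ultimately show ?thesis by simp
qed

text \<open>The preimage of \<open>N\<close> under the linear map sending \<open>p\<close> to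
  \<open>p v_i\<close>. Being an ideal, it contains a generated ideal as soon as it contains the
  generators.\<close>

lemma ideal_coefficients:
  fixes N :: "'a::comm_ring_1 vec set"
  assumes N: "submodule class_ring N (module_vec TYPE('a) s)"
  shows "ideal {p. p \<cdot>\<^sub>v unit_vec s i \<in> N} class_ring"
proof (rule ideal_class_ringI; clarify)
  have "0 \<cdot>\<^sub>v unit_vec s i = (0\<^sub>v s :: 'a vec)" by auto
  then show "0 \<cdot>\<^sub>v unit_vec s i \<in> N" using submodule_module_vecD(2)[OF N] by simp
next
  fix p q
  assume "p \<cdot>\<^sub>v unit_vec s i \<in> N" "q \<cdot>\<^sub>v unit_vec s i \<in> N"
  then show "(p + q) \<cdot>\<^sub>v unit_vec s i \<in> N"
    using submodule_module_vecD(3)[OF N] by (simp add: add_smult_distrib_vec)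
next
  fix r p
  assume "p \<cdot>\<^sub>v unit_vec s i \<in> N"
  from submodule_module_vecD(4)[OF N this, of r] show "(r * p) \<cdot>\<^sub>v unit_vec s i \<in> N"
    by (simp add: smult_smult_assoc)
qed

section \<open>The initial module as a direct sum of squarefree monomial ideals\<close>

theorem theorem2p3:
  fixes s l :: nat
    and c :: "nat \<Rightarrow> nat \<Rightarrow> 'k::field_char_0"
    and \<alpha> :: "nat \<Rightarrow> nat \<Rightarrow> 'n::finite monom"
    and \<gamma> \<beta> :: "nat \<Rightarrow> 'n \<Rightarrow> int"
    and mord :: "'n monom \<Rightarrow> 'n monom \<Rightarrow> bool"
    and bord :: "nat \<Rightarrow> nat \<Rightarrow> bool"
  assumes "multigraded (term_matrix s l c \<alpha>)"
    and "squarefree_matrix s l c \<alpha>"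
    and "squarefree_solution s l c \<alpha> \<gamma> \<beta>"
    and "monomial_order mord"
    and "basis_order s bord"
  shows "\<exists>I :: nat \<Rightarrow> ('n, 'k) polyring set.
    (\<forall>i<s. squarefree_monomial_ideal (I i)) \<and>
    initial_module s (term_less mord bord) (phi s l c \<alpha> ` carrier_vec l) = ideal_direct_sum s I"
proof -
  let ?less = "term_less mord bord"
  let ?N = "phi s l c \<alpha> ` carrier_vec l"
  let ?LT = "leading_term ?less ` (?N - {0\<^sub>v s})"
  let ?span = "LinearCombinations.module.span class_ring (module_vec TYPE(('n, 'k) polyring) s)"
  let ?x = "\<lambda>a. Poly_Mapping.single a 1 :: ('n, 'k) polyring"
  \<comment> \<open>Only the squarefree leading exponents at \<open>v_i\<close> are taken as
    generators. Thus \<open>I i\<close> is squarefree by construction, and the work lies in showing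
    that these generate all leading terms.\<close>
  define S where "S = (\<lambda>i. {a. squarefree_vec (Poly_Mapping.lookup a) \<and> (\<exists>f\<in>?N. is_leading ?less f (a, i))})"
  define I where "I = (\<lambda>i. Idl\<^bsub>class_ring\<^esub> (?x ` S i))"
  have sqf: "squarefree_monomial_ideal (I i)" for i
    unfolding squarefree_monomial_ideal_def I_def by (rule exI[of _ "S i"]) (auto simp: S_def)
  have I_ideal: "ideal (I i) class_ring" for i
    unfolding I_def by (rule ring.genideal_ideal[OF class_ring.ring_axioms]) simp
  have gens: "?x ` S i \<subseteq> I i" for i
    unfolding I_def by (rule ring.genideal_self[OF class_ring.ring_axioms]) simp
  have lt: "leading_term ?less f = Poly_Mapping.single u (Poly_Mapping.lookup (f $ i) u) \<cdot>\<^sub>v unit_vec s i"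
    if "f \<in> ?N" "is_leading ?less f (u, i)" for f u i
  proof (rule leading_term_eq[OF assms(4,5) _ that(2)])
    show "f \<in> carrier_vec s" using that(1) phi_carrier by blast
  qed
  have LT_carrier: "?LT \<subseteq> carrier_vec s"
    using leading_term_carrier[OF phi_carrier] by blast
  have span_sub: "submodule class_ring (?span ?LT) (module_vec TYPE(('n, 'k) polyring) s)"
    using LT_carrier by (rule submodule_span_vec)
  have "?span ?LT \<subseteq> ideal_direct_sum s I"
  proof (rule span_vec_least)
    show "submodule class_ring (ideal_direct_sum s I) (module_vec TYPE(('n, 'k) polyring) s)"
      using I_ideal by (rule submodule_ideal_direct_sum)
    show "?LT \<subseteq> ideal_direct_sum s I"
    proof
      fix v
      assume "v \<in> ?LT"
      then obtain w where w: "w \<in> carrier_vec l" "phi s l c \<alpha> w \<noteq> 0\<^sub>v s"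
        and v: "v = leading_term ?less (phi s l c \<alpha> w)" by auto
      let ?f = "phi s l c \<alpha> w"
      obtain u i where lead: "is_leading ?less ?f (u, i)"
        using ex_is_leading[OF assms(4,5) phi_carrier w(2)] by auto
      obtain a e w' where ua: "u = e + a" and a: "squarefree_vec (Poly_Mapping.lookup a)"
          "w' \<in> carrier_vec l" "is_leading ?less (phi s l c \<alpha> w') (a, i)"
        by (rule squarefree_leading_divisor[OF assms(3,4) w(1) lead])
      from a have "a \<in> S i" unfolding S_def by blast
      then have "?x a \<in> I i" using gens by blast
      \<comment> \<open>Multiplying the generator \<open>x^a\<close> by \<open>x^e\<close> with the
        leading coefficient of \<open>?f\<close> recovers the leading term, as
        \<open>u = e + a\<close>.\<close>
      then have "Poly_Mapping.single e (Poly_Mapping.lookup (?f $ i) u) * ?x a \<in> I i"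
        by (rule idealD_class_ring(3)[OF I_ideal])
      then have "Poly_Mapping.single u (Poly_Mapping.lookup (?f $ i) u) \<in> I i"
        by (simp only: mult_single ua mult_1_right)
      moreover have "v = Poly_Mapping.single u (Poly_Mapping.lookup (?f $ i) u) \<cdot>\<^sub>v unit_vec s i"
        unfolding v by (rule lt[OF imageI[OF w(1)] lead])
      ultimately show "v \<in> ideal_direct_sum s I"
        using idealD_class_ring(1)[OF I_ideal] by (simp add: ideal_direct_sum_def unit_vec_def)
    qed
  qed
  moreover have "ideal_direct_sum s I \<subseteq> ?span ?LT"
  proof
    fix f
    assume f: "f \<in> ideal_direct_sum s I"
    show "f \<in> ?span ?LT"
    proof (rule vec_in_submodule[OF span_sub])
      show "f \<in> carrier_vec s" using f by (simp add: ideal_direct_sum_def)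
      fix i
      assume i: "i < s"
      \<comment> \<open>The containment of \<open>f $ i\<close> times \<open>v_i\<close> in the span
        is reduced to the generators of \<open>I i\<close>, by comparing \<open>I i\<close> with
        this ideal.\<close>
      let ?P = "{p. p \<cdot>\<^sub>v unit_vec s i \<in> ?span ?LT}"
      have P: "ideal ?P class_ring" using span_sub by (rule ideal_coefficients)
      have "?x ` S i \<subseteq> ?P"
      proof
        fix p
        assume "p \<in> ?x ` S i"
        then obtain a g where p: "p = ?x a" and g: "g \<in> ?N" and lead: "is_leading ?less g (a, i)"
          by (auto simp: S_def)
        let ?b = "Poly_Mapping.lookup (g $ i) a"
        have b: "?b \<noteq> 0"
          using lead unfolding is_leading_def monomials_of_def in_keys_iff by blast
        then have "g \<noteq> 0\<^sub>v s"
          using i by (metis index_zero_vec(1) lookup_zero)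
        with g have "leading_term ?less g \<in> ?span ?LT"
          using span_vec_superset[OF LT_carrier] by blast
        then have "Poly_Mapping.single a ?b \<in> ?P"
          unfolding lt[OF g lead] by (rule CollectI)
        \<comment> \<open>A leading term carries a coefficient, whereas the generators of
          \<open>I i\<close> are monic; over a field the nonzero \<open>?b\<close> is removed by a
          constant polynomial.\<close>
        then have "Poly_Mapping.single 0 (inverse ?b) * Poly_Mapping.single a ?b \<in> ?P"
          by (rule idealD_class_ring(3)[OF P])
        then show "p \<in> ?P"
          unfolding mult_single left_inverse[OF b] add_0_left p .
      qed
      then have "I i \<subseteq> ?P"
        unfolding I_def by (rule ring.genideal_minimal[OF class_ring.ring_axioms P])
      then show "f $ i \<cdot>\<^sub>v unit_vec s i \<in> ?span ?LT"
        using f i by (auto simp: ideal_direct_sum_def)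
    qed
  qed
  ultimately have "initial_module s ?less ?N = ideal_direct_sum s I"
    unfolding initial_module_def by (rule equalityI)
  with sqf show ?thesis by blast
qed

end
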